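(* Let $\mu$ be the stationary Markov measure on $(\mathbb{Z}/3\mathbb{Z})^{\mathbb{Z}}$ with transition matrix $$\mathbf{P}=\begin{pmatrix}1/2&0&1/2\\1/2&0&1/2\\0&1&0\end{pmatrix},$$ where the entry $p_{ij}$ ($i,j\in\{0,1,2\}$) is the probability of a transition from symbol $j$ to symbol $i$. Let $\Phi:(\mathbb{Z}/3\mathbb{Z})^{\mathbb{Z}}\to(\mathbb{Z}/2\mathbb{Z})^{\mathbb{Z}}$ be the map that acts coordinatewise by $0\mapsto 0$, $1\mapsto 1$, $2\mapsto 1$, and let $\nu=\Phi\mu$ be the pushforward measure on $(\mathbb{Z}/2\mathbb{Z})^{\mathbb{Z}}$. Then $\nu$ is not harmonically mixing.
   Context: With $\mathcal{A}=\mathbb{Z}/2\mathbb{Z}$, a character of $\mathcal{A}^{\mathbb{Z}}$ is a continuous homomorphism $\boldsymbol\chi:\mathcal{A}^{\mathbb{Z}}\to\{z\in\mathbb{C}:|z|=1\}$; it has the form $\boldsymbol\chi(\mathbf{a})=\prod_{k\in\mathbb{K}}\chi_k(a_k)$ with $\mathbb{K}\subset\mathbb{Z}$ finite and each $\chi_k$ a nontrivial character of $\mathcal{A}$, and $\mathrm{rank}(\boldsymbol\chi)=\#\mathbb{K}$. A probability measure $\nu$ on $\mathcal{A}^{\mathbb{Z}}$ is harmonically mixing if for every $\epsilon>0$ there is $R\in\mathbb{N}$ such that every character $\boldsymbol\chi$ with $\mathrm{rank}(\boldsymbol\chi)>R$ satisfies $|\int\boldsymbol\chi\,d\nu|<\epsilon$.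 *)

theory Defs
  imports "HOL-Probability.Probability" "HOL-Library.Numeral_Type"
begin

text \<open>
  The groups Z/2Z and Z/3Z are the types \<open>2\<close> and \<open>3\<close> of \<^theory>\<open>HOL-Library.Numeral_Type\<close>, whose
  arithmetic is modulo 2 and 3. A bi-infinite sequence over \<open>'a\<close> is a function \<open>int \<Rightarrow> 'a\<close>,
  with pointwise addition.
\<close>

definition seq_space :: "(int \<Rightarrow> 'a) measure" where
  "seq_space = PiM UNIV (\<lambda>_. count_space UNIV)"

definition seq_topology :: "(int \<Rightarrow> 'a) topology" where
  "seq_topology = product_topology (\<lambda>_. discrete_topology UNIV) UNIV"

subsection \<open>Characters and harmonic mixing\<close>

definition symbol_character :: "('a::{ab_group_add,finite} \<Rightarrow> complex) \<Rightarrow> bool" where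
  "symbol_character c \<longleftrightarrow> (\<forall>x y. c (x + y) = c x * c y) \<and> (\<forall>x. cmod (c x) = 1)"

definition nontrivial_symbol_character :: "('a::{ab_group_add,finite} \<Rightarrow> complex) \<Rightarrow> bool" where
  "nontrivial_symbol_character c \<longleftrightarrow> symbol_character c \<and> (\<exists>x. c x \<noteq> 1)"

definition seq_character :: "((int \<Rightarrow> 'a::{ab_group_add,finite}) \<Rightarrow> complex) \<Rightarrow> bool" where
  "seq_character \<psi> \<longleftrightarrow>
     continuous_map seq_topology euclidean \<psi> \<and>
     (\<forall>a b. \<psi> (\<lambda>k. a k + b k) = \<psi> a * \<psi> b) \<and>
     (\<forall>a. cmod (\<psi> a) = 1)"

definition factors_over :: "((int \<Rightarrow> 'a::{ab_group_add,finite}) \<Rightarrow> complex) \<Rightarrow> int set \<Rightarrow> bool" where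
  "factors_over \<psi> K \<longleftrightarrow> finite K \<and>
     (\<exists>c. (\<forall>k\<in>K. nontrivial_symbol_character (c k)) \<and> (\<forall>a. \<psi> a = (\<Prod>k\<in>K. c k (a k))))"

definition character_rank :: "((int \<Rightarrow> 'a::{ab_group_add,finite}) \<Rightarrow> complex) \<Rightarrow> nat" where
  "character_rank \<psi> = card (THE K. factors_over \<psi> K)"

lemma symbol_character_zero: "symbol_character c \<Longrightarrow> c 0 = 1"
  unfolding symbol_character_def
  by (metis add_0 mult_cancel_right2 norm_zero zero_neq_one)

lemma factors_over_support:
  assumes "factors_over \<psi> K"
  shows "K = {k. \<exists>x. \<psi> ((\<lambda>_. 0)(k := x)) \<noteq> 1}"
proof -
  from assms obtain c where fin: "finite K"
    and c: "\<And>k. k \<in> K \<Longrightarrow> nontrivial_symbol_character (c k)"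
    and \<psi>: "\<And>a. \<psi> a = (\<Prod>k\<in>K. c k (a k))"
    unfolding factors_over_def by blast
  have zero: "c k 0 = 1" if "k \<in> K" for k
    using c[OF that] by (simp add: nontrivial_symbol_character_def symbol_character_zero)
  have "\<psi> ((\<lambda>_. 0)(k := x)) = (if k \<in> K then c k x else 1)" for k x
  proof -
    have "(\<Prod>j\<in>K. c j (((\<lambda>_. 0)(k := x)) j)) = (\<Prod>j\<in>K. if j = k then c k x else 1)"
      by (rule prod.cong) (auto simp: zero)
    then show ?thesis using fin by (simp add: \<psi>)
  qed
  then show ?thesis
    using c by (auto simp: nontrivial_symbol_character_def)
qed

lemma character_rank_eq: "factors_over \<psi> K \<Longrightarrow> character_rank \<psi> = card K"
  unfolding character_rank_def
  by (metis factors_over_support the_equality)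

definition harmonically_mixing :: "(int \<Rightarrow> 'a::{ab_group_add,finite}) measure \<Rightarrow> bool" where
  "harmonically_mixing \<nu> \<longleftrightarrow>
     (\<forall>\<epsilon>>0. \<exists>R::nat. \<forall>\<psi>. seq_character \<psi> \<and> character_rank \<psi> > R \<longrightarrow>
        cmod (\<integral>a. \<psi> a \<partial>\<nu>) < \<epsilon>)"

subsection \<open>Stationary Markov measures\<close>

text \<open>
  Transition matrices act on column vectors: the entry \<open>P $ i $ j\<close> is the probability of a
  transition from \<open>j\<close> to \<open>i\<close>. As the cylinder formula below does not depend on the position \<open>m\<close>,
  such a measure is shift-invariant.
\<close>

definition stationary_markov_measure ::
    "real^'a^'a \<Rightarrow> (int \<Rightarrow> 'a::finite) measure \<Rightarrow> bool" where
  "stationary_markov_measure P \<mu> \<longleftrightarrow>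
     prob_space \<mu> \<and> sets \<mu> = sets seq_space \<and>
     (\<exists>\<pi> :: real^'a. (\<forall>i. \<pi> $ i \<ge> 0) \<and> (\<Sum>i\<in>UNIV. \<pi> $ i) = 1 \<and> P *v \<pi> = \<pi> \<and>
        (\<forall>(m::int) (n::nat) w.
           measure \<mu> {x. \<forall>i\<le>n. x (m + int i) = w i} =
             \<pi> $ w 0 * (\<Prod>i<n. P $ w (Suc i) $ w i)))"

subsection \<open>The example\<close>

text \<open>The components of \<open>vector [a, b, c]\<close> are indexed 1, 2, 3 = 0; here the order is 0, 1, 2.\<close>

definition triple :: "'b \<Rightarrow> 'b \<Rightarrow> 'b \<Rightarrow> 3 \<Rightarrow> 'b" where
  "triple a b c i = (if i = 0 then a else if i = 1 then b else c)"

definition transition_matrix :: "real^3^3" where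
  "transition_matrix = (\<chi> i j.
     triple (triple (1/2) 0 (1/2))
            (triple (1/2) 0 (1/2))
            (triple   0   1   0  ) i j)"

definition factor_map :: "(int \<Rightarrow> 3) \<Rightarrow> (int \<Rightarrow> 2)" where
  "factor_map x = (\<lambda>k. triple 0 1 1 (x k))"

end

theory Submission imports Defs begin

text \<open>
  The chain visits state 1 only on its way to state 2, and state 2 only from state 1, so the
  symbol 1 occurs in the image sequence in blocks of even length, each a concatenation of pairs
  coming from the states 1, 2. Hence the parity of the number of ones in a window depends only on
  whether the window cuts a pair at its left end or at its right end. As an identity of signs, let
  \<open>h\<close> be \<open>-1\<close> on the state 2 and \<open>1\<close> on the others; then almost surely
  \<open>(-1) ^ a\<^sub>k = h x\<^sub>k * h x\<^sub>k\<^sub>+\<^sub>1\<close>, where \<open>a\<close> is the image of the path \<open>x\<close>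
  (\<open>bit_sign_cocycle\<close>). The product over a window of length \<open>n\<close>, a character of rank \<open>n\<close>,
  telescopes to \<open>h x\<^sub>0 * h x\<^sub>n\<close>.

  Only a two-point correlation of the chain remains. By mixing it tends to the square of the mean
  of \<open>h\<close>, which is \<open>(1/3)\<^sup>2 = 1/9\<close> because the stationary distribution is uniform; so the integrals
  of these characters do not tend to zero with the rank. The recursion
  \<open>markov_pair_recursion\<close> gives an exact value: the joint probability of the state 2 at time 0 and
  the state 1 at time \<open>m\<close> is \<open>(1 - (-1/2) ^ m) / 9\<close>, and for odd \<open>m\<close> this makes the integral
  over the window of length \<open>m + 1\<close> exceed \<open>1/9\<close>.
\<close>

section \<open>Two-point probabilities of a Markov measure\<close>

lemma measurable_seq_coordinate:
  fixes \<mu> :: "(int \<Rightarrow> 'a) measure"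
  assumes "sets \<mu> = sets seq_space"
  shows "(\<lambda>x. x k) \<in> measurable \<mu> (count_space UNIV)"
proof -
  have "(\<lambda>x. x k) \<in> measurable seq_space (count_space (UNIV :: 'a set))"
    unfolding seq_space_def by (rule measurable_component_singleton) simp
  then show ?thesis
    using measurable_cong_sets[OF assms refl] by blast
qed

lemma space_seq: "sets \<mu> = sets seq_space \<Longrightarrow> space \<mu> = (UNIV :: (int \<Rightarrow> 'a) set)"
  using sets_eq_imp_space_eq[of \<mu> seq_space] by (simp add: seq_space_def space_PiM)

text \<open>
  The cylinder formula concerns full words, so the unconstrained intermediate coordinates are
  summed out: both sides are expanded over all words \<open>w\<close> of length \<open>n + 1\<close>, and appending one
  letter \<open>t\<close> to \<open>w\<close> multiplies the probability of its cylinder by the transition probability from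
  its last letter.
\<close>

lemma markov_pair_recursion:
  fixes \<mu> :: "(int \<Rightarrow> 'a::finite) measure" and P :: "real^'a^'a" and \<pi> :: "real^'a"
  assumes "prob_space \<mu>" and sets: "sets \<mu> = sets seq_space"
    and cyl: "\<And>n w. measure \<mu> {x. \<forall>i\<le>n. x (m + int i) = w i} =
      \<pi> $ w 0 * (\<Prod>i<n. P $ w (Suc i) $ w i)"
  shows "measure \<mu> {x. x m = s \<and> x (m + int (Suc n)) = t} =
    (\<Sum>a\<in>UNIV. P $ t $ a * measure \<mu> {x. x m = s \<and> x (m + int n) = a})"
proof -
  interpret prob_space \<mu> by fact
  note [measurable] = measurable_seq_coordinate[OF sets]
  have space[simp]: "space \<mu> = UNIV" by (rule space_seq[OF sets])
  define W :: "(nat \<Rightarrow> 'a) set" where "W = ({..n} \<rightarrow>\<^sub>E UNIV)"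
  define C where "C w = {x. \<forall>i\<le>n. x (m + int i) = w i}" for w :: "nat \<Rightarrow> 'a"
  have [simp]: "finite W" unfolding W_def by (intro finite_PiE) auto
  have ev: "{x. Q x} \<in> events" if "Measurable.pred \<mu> Q" for Q
    using that by (simp add: pred_def)
  have split: "prob {x. Q x} = (\<Sum>w\<in>W. prob {x. x \<in> C w \<and> Q x})"
    if Q: "Measurable.pred \<mu> Q" for Q
  proof -
    note [measurable] = Q
    have "{x. Q x} = (\<Union>w\<in>W. {x. x \<in> C w \<and> Q x})"
    proof (intro set_eqI iffI)
      fix x assume "x \<in> {x. Q x}"
      then show "x \<in> (\<Union>w\<in>W. {x. x \<in> C w \<and> Q x})"
        by (intro UN_I[of "restrict (\<lambda>i. x (m + int i)) {..n}"]) (auto simp: W_def C_def)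
    qed auto
    moreover have "disjoint_family_on (\<lambda>w. {x. x \<in> C w \<and> Q x}) W"
      by (auto simp: disjoint_family_on_def W_def C_def intro!: PiE_ext)
    moreover have "{x. x \<in> C w \<and> Q x} \<in> events" for w
      unfolding C_def mem_Collect_eq by (intro ev) measurable
    ultimately show ?thesis
      using finite_measure_finite_Union[of W "\<lambda>w. {x. x \<in> C w \<and> Q x}"] by auto
  qed
  have short: "prob {x. x m = s \<and> x (m + int n) = a} =
      (\<Sum>w\<in>W. if w 0 = s \<and> w n = a then prob (C w) else 0)" for a
  proof -
    have "{x. x \<in> C w \<and> x m = s \<and> x (m + int n) = a} =
        (if w 0 = s \<and> w n = a then C w else {})" for w
      by (auto simp: C_def dest: spec[of _ 0] spec[of _ n])
    then show ?thesis by (subst split) (auto intro!: sum.cong)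
  qed
  have step: "prob {x. x \<in> C w \<and> x m = s \<and> x (m + int (Suc n)) = t} =
      (if w 0 = s then P $ t $ w n * prob (C w) else 0)" for w
  proof -
    have "{x. x \<in> C w \<and> x m = s \<and> x (m + int (Suc n)) = t} =
        (if w 0 = s then {x. \<forall>i\<le>Suc n. x (m + int i) = (w(Suc n := t)) i} else {})"
      by (auto simp: C_def le_Suc_eq dest: spec[of _ 0])
    moreover have "(\<Prod>i<n. P $ (w(Suc n := t)) (Suc i) $ (w(Suc n := t)) i) =
        (\<Prod>i<n. P $ w (Suc i) $ w i)"
      by (rule prod.cong) auto
    ultimately show ?thesis
      by (simp add: cyl C_def del: of_nat_Suc fun_upd_apply) (simp add: fun_upd_apply)
  qed
  have "prob {x. x m = s \<and> x (m + int (Suc n)) = t} =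
      (\<Sum>w\<in>W. if w 0 = s then P $ t $ w n * prob (C w) else 0)"
    by (subst split) (simp_all add: step del: of_nat_Suc)
  also have "\<dots> = (\<Sum>w\<in>W. \<Sum>a\<in>UNIV.
      P $ t $ a * (if w 0 = s \<and> w n = a then prob (C w) else 0))"
    by (intro sum.cong refl) (simp add: if_distrib[of "\<lambda>u. _ * u"] cong: if_cong)
  also have "\<dots> = (\<Sum>a\<in>UNIV. P $ t $ a * prob {x. x m = s \<and> x (m + int n) = a})"
    by (subst sum.swap) (simp add: short sum_distrib_left)
  finally show ?thesis .
qed

section \<open>Characters on windows\<close>

lemma type_2_cases: "a = 0 \<or> a = (1::2)"
proof -
  have "(2::2) = 0" by simp
  then show ?thesis using exhaust_2[of a] by metis
qed

text \<open>
  The nontrivial character of Z/2Z. It is kept real-valued so that products can be handled over the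
  reals and embedded into the complex numbers only once.
\<close>

definition bit_sign :: "2 \<Rightarrow> real" where
  "bit_sign a = (if a = 0 then 1 else -1)"

definition walsh :: "nat \<Rightarrow> (int \<Rightarrow> 2) \<Rightarrow> complex" where
  "walsh n a = complex_of_real (\<Prod>k<n. bit_sign (a (int k)))"

lemma bit_sign_add: "bit_sign (a + b) = bit_sign a * bit_sign b"
  using type_2_cases[of a] type_2_cases[of b] by (auto simp: bit_sign_def)

lemma abs_bit_sign: "\<bar>bit_sign a\<bar> = 1"
  by (simp add: bit_sign_def)

lemma nontrivial_bit_sign: "nontrivial_symbol_character (\<lambda>a. complex_of_real (bit_sign a))"
proof -
  have "complex_of_real (bit_sign 1) \<noteq> 1"
    by (simp add: bit_sign_def)
  then show ?thesis
    by (auto simp: nontrivial_symbol_character_def symbol_character_def bit_sign_add abs_bit_sign)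
qed

lemma seq_character_walsh: "seq_character (walsh n)"
proof -
  have coord: "continuous_map seq_topology euclideanreal (\<lambda>a. bit_sign (a (int k)))" for k
  proof -
    have "continuous_map seq_topology (discrete_topology UNIV) (\<lambda>a :: int \<Rightarrow> 2. a (int k))"
      unfolding seq_topology_def by (rule continuous_map_product_projection) simp
    moreover have "continuous_map (discrete_topology UNIV) euclideanreal bit_sign"
      by simp
    ultimately show ?thesis
      using continuous_map_compose[of seq_topology "discrete_topology UNIV" _ euclideanreal bit_sign]
      by (simp add: comp_def)
  qed
  have "continuous_map seq_topology euclideanreal (\<lambda>a. \<Prod>k<n. bit_sign (a (int k)))"
    by (rule continuous_map_prod) (simp_all add: coord)
  moreover have "continuous_map euclideanreal euclidean complex_of_real"
    by (simp add: continuous_on_of_real)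
  ultimately have "continuous_map seq_topology euclidean (walsh n)"
    using continuous_map_compose[of seq_topology euclideanreal _ euclidean complex_of_real]
    by (simp add: comp_def walsh_def[abs_def] del: of_real_prod)
  then show ?thesis
    by (simp add: seq_character_def walsh_def bit_sign_add prod.distrib abs_prod abs_bit_sign
        del: of_real_prod)
qed

lemma rank_walsh: "character_rank (walsh n) = n"
proof -
  have "factors_over (walsh n) (int ` {..<n})"
    using nontrivial_bit_sign
    by (auto simp: factors_over_def walsh_def prod.reindex
        intro!: exI[of _ "\<lambda>_ a. complex_of_real (bit_sign a)"])
  then show ?thesis
    by (simp add: character_rank_eq card_image)
qed

section \<open>The three-state chain\<close>

definition state_sign :: "3 \<Rightarrow> real" where
  "state_sign s = (if s = 2 then -1 else 1)"

lemma sum_UNIV_3: "(\<Sum>i\<in>UNIV. f i) = f 0 + f 1 + f (2::3)"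
proof -
  have "(3::3) = 0" by simp
  then show ?thesis by (simp only: sum_3) (simp add: ac_simps)
qed

lemma exhaust3: "s = 0 \<or> s = 1 \<or> s = (2::3)"
  using exhaust_3[of s] by auto

lemma transition_matrix_0: "transition_matrix $ 0 $ s = (if s = 1 then 0 else 1/2)"
  and transition_matrix_1: "transition_matrix $ 1 $ s = (if s = 1 then 0 else 1/2)"
  and transition_matrix_2: "transition_matrix $ 2 $ s = (if s = 1 then 1 else 0)"
  using exhaust3[of s] by (auto simp: transition_matrix_def triple_def)

text \<open>
  The reason for the failure of harmonic mixing: along allowed transitions the character of a single
  image symbol is a multiplicative coboundary. Indeed 1 is always followed by 2, so the factors
  are 1 and \<open>-1\<close>, while 0 and 2 are never followed by 2, so the second factor is 1 and the first one
  is \<open>-1\<close> exactly for 2.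
\<close>

lemma bit_sign_cocycle:
  assumes "transition_matrix $ t $ s \<noteq> 0"
  shows "bit_sign (triple 0 1 1 s) = state_sign s * state_sign t"
  using exhaust3[of s] exhaust3[of t] assms
  by (auto simp: transition_matrix_0 transition_matrix_1 transition_matrix_2
      bit_sign_def state_sign_def triple_def)

lemma stationary_uniform:
  assumes "transition_matrix *v \<pi> = \<pi>" "(\<Sum>i\<in>UNIV. \<pi> $ i) = 1"
  shows "\<pi> $ i = 1/3"
proof -
  have "(\<Sum>k\<in>UNIV. transition_matrix $ j $ k * \<pi> $ k) - \<pi> $ j = 0" for j
    using assms(1) by (simp add: matrix_vector_mult_def vec_eq_iff)
  from this[of 0] this[of 1] this[of 2]
  have "\<pi> $ 1 = \<pi> $ 0" "\<pi> $ 2 = \<pi> $ 0"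
    by (simp_all add: sum_UNIV_3 transition_matrix_0 transition_matrix_1 transition_matrix_2)
  with assms(2) exhaust3[of i] show ?thesis
    by (auto simp: sum_UNIV_3)
qed

section \<open>Failure of harmonic mixing\<close>

theorem mainTheorem2:
  fixes \<mu> :: "(int \<Rightarrow> 3) measure" and \<nu> :: "(int \<Rightarrow> 2) measure"
  assumes "stationary_markov_measure transition_matrix \<mu>"
    and "\<nu> = distr \<mu> seq_space factor_map"
  shows "\<not> harmonically_mixing \<nu>"
proof -
  obtain \<pi> where "prob_space \<mu>" and sets: "sets \<mu> = sets seq_space"
    and \<pi>: "(\<Sum>i\<in>UNIV. \<pi> $ i) = 1" "transition_matrix *v \<pi> = \<pi>"
    and cyl: "\<And>m n w. measure \<mu> {x. \<forall>i\<le>n. x (m + int i) = w i} =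
      \<pi> $ w 0 * (\<Prod>i<n. transition_matrix $ w (Suc i) $ w i)"
    using assms(1) unfolding stationary_markov_measure_def by blast
  interpret prob_space \<mu> by fact
  note [measurable] = measurable_seq_coordinate[OF sets]
  have space[simp]: "space \<mu> = UNIV" by (rule space_seq[OF sets])
  have total: "prob UNIV = 1" using prob_space by simp
  note uniform = stationary_uniform[OF \<pi>(2,1)]
  have marginal: "prob {x. x m = s} = 1/3" for m s
    using cyl[of 0 m "\<lambda>_. s"] by (simp add: uniform)
  have ev: "{x. x m = s \<and> x l = t} \<in> events" for m s l t
    proof -
    have "Measurable.pred \<mu> (\<lambda>x. x m = s \<and> x l = t)" by measurable
    then show ?thesis by (simp add: pred_def)
  qed

  have allowed: "AE x in \<mu>. \<forall>k. transition_matrix $ x (k + 1) $ x k \<noteq> 0"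
  proof (subst AE_all_countable, intro allI)
    fix k
    have "AE x in \<mu>. transition_matrix $ t $ s = 0 \<longrightarrow> \<not> (x k = s \<and> x (k + 1) = t)" for s t
    proof (cases "transition_matrix $ t $ s = 0")
      case True
      have "{x. \<forall>i\<le>Suc 0. x (k + int i) = (case i of 0 \<Rightarrow> s | Suc _ \<Rightarrow> t)} =
          {x. x k = s \<and> x (k + 1) = t}"
        by (auto simp: le_Suc_eq)
      then have "prob {x. x k = s \<and> x (k + 1) = t} = 0"
        using cyl[of "Suc 0" k "\<lambda>i. case i of 0 \<Rightarrow> s | Suc _ \<Rightarrow> t"] True by simp
      then show ?thesis
        using ev by (subst (asm) prob_eq_0) auto
    qed simp
    then have "AE x in \<mu>. \<forall>s t. transition_matrix $ t $ s = 0 \<longrightarrow> \<not> (x k = s \<and> x (k + 1) = t)"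
      unfolding AE_all_countable by blast
    then show "AE x in \<mu>. transition_matrix $ x (k + 1) $ x k \<noteq> 0"
      by eventually_elim blast
  qed

  have telescope: "AE x in \<mu>. walsh n (factor_map x) =
      complex_of_real (state_sign (x 0) * state_sign (x (int n)))" for n
    using allowed
  proof eventually_elim
    case (elim x)
    show ?case
    proof (induction n)
      case (Suc n)
      have "bit_sign (factor_map x (int n)) = state_sign (x (int n)) * state_sign (x (int (Suc n)))"
        using bit_sign_cocycle[OF elim[rule_format, of "int n"]]
        by (simp add: factor_map_def ac_simps)
      moreover have "state_sign s * (state_sign s * u) = u" for s u
        by (simp add: state_sign_def)
      ultimately show ?case
        using Suc by (simp add: walsh_def mult.assoc del: of_real_prod of_nat_Suc flip: of_real_mult)
    qed (simp add: walsh_def state_sign_def)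
  qed

  define J where "J n t = prob {x. x 0 = 2 \<and> x (int n) = t}" for n t
  have J_Suc: "J (Suc n) t = (\<Sum>a\<in>UNIV. transition_matrix $ t $ a * J n a)" for n t
    using markov_pair_recursion[OF \<open>prob_space \<mu>\<close> sets cyl, of 0 2 n t] by (simp add: J_def)
  have J_0: "J 0 t = (if t = 2 then 1/3 else 0)" for t
  proof -
    have "{x :: int \<Rightarrow> 3. x 0 = 2 \<and> x 0 = t} = (if t = 2 then {x. x 0 = 2} else {})"
      by auto
    then show ?thesis by (simp add: J_def marginal)
  qed
  \<comment> \<open>The total mass closes the recursion: the state 1 is entered with probability 1/2 from each of the
    states 0 and 2, whose joint mass is 1/3 minus that of the state 1.\<close>
  have J_eq: "J n 0 + J n 1 + J n 2 = 1/3 \<and> J n 1 = (1 - (-1/2) ^ n) / 9" for n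
  proof (induction n)
    case 0
    then show ?case by (simp add: J_0)
  next
    case (Suc n)
    then show ?case
      by (simp add: J_Suc sum_UNIV_3 transition_matrix_0 transition_matrix_1 transition_matrix_2
          field_simps)
  qed

  have factor[measurable]: "factor_map \<in> measurable \<mu> seq_space"
    unfolding seq_space_def factor_map_def by (rule measurable_PiM_single') auto
  have walsh_meas: "walsh n \<in> borel_measurable seq_space" for n
  proof -
    note [measurable] = measurable_seq_coordinate[OF refl]
    show ?thesis unfolding walsh_def by measurable
  qed
  have integral: "(\<integral>a. walsh n a \<partial>\<nu>) = complex_of_real (4 * J n 2 - 1/3)" for n
  proof -
    have "(\<integral>a. walsh n a \<partial>\<nu>) = (\<integral>x. walsh n (factor_map x) \<partial>\<mu>)"
      unfolding assms(2) by (rule integral_distr[OF factor walsh_meas])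
    also have "\<dots> = (\<integral>x. complex_of_real (state_sign (x 0) * state_sign (x (int n))) \<partial>\<mu>)"
      using telescope walsh_meas
      by (intro integral_cong_AE) (auto intro: measurable_compose[OF factor])
    also have "\<dots> = complex_of_real (\<integral>x. state_sign (x 0) * state_sign (x (int n)) \<partial>\<mu>)"
      by (rule integral_complex_of_real)
    \<comment> \<open>Each sign is 1 minus twice the indicator of the state 2.\<close>
    also have "(\<integral>x. state_sign (x 0) * state_sign (x (int n)) \<partial>\<mu>) =
        (\<integral>x. 1 - 2 * indicator {x. x 0 = 2} x - 2 * indicator {x. x (int n) = 2} x
          + 4 * indicator {x. x 0 = 2 \<and> x (int n) = 2} x \<partial>\<mu>)"
      by (intro Bochner_Integration.integral_cong refl)
         (auto simp: state_sign_def indicator_def)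
    also have "\<dots> = 4 * J n 2 - 1/3"
      using ev[of 0 2 0 2] ev[of "int n" 2 "int n" 2] ev[of 0 2 "int n" 2]
      by (simp add: J_def marginal total emeasure_eq_measure)
    finally show ?thesis .
  qed

  \<comment> \<open>An even window length \<open>2 * R + 2\<close> gives an odd exponent \<open>2 * R + 1\<close>, since the state 2 is
    entered exactly from the state 1, one step earlier; then the correction to 1/9 is positive.\<close>
  have large: "cmod (\<integral>a. walsh (2 * R + 2) a \<partial>\<nu>) > 1/9" for R
  proof -
    have "J (2 * R + 2) 2 = J (2 * R + 1) 1"
      using J_Suc[of "2 * R + 1" 2] by (simp add: sum_UNIV_3 transition_matrix_2)
    also have "\<dots> = (1 + (1/2) ^ (2 * R + 1)) / 9"
      using J_eq[of "2 * R + 1"] by (simp add: power_minus_odd)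
    finally have "J (2 * R + 2) 2 > 1/9"
      by simp
    then show ?thesis
      unfolding integral norm_of_real by simp
  qed
  show ?thesis
  proof
    assume "harmonically_mixing \<nu>"
    then obtain R where R: "\<And>\<psi>. seq_character \<psi> \<Longrightarrow> character_rank \<psi> > R \<Longrightarrow>
        cmod (\<integral>a. \<psi> a \<partial>\<nu>) < 1/9"
      unfolding harmonically_mixing_def by (metis zero_less_divide_1_iff zero_less_numeral)
    from R[of "walsh (2 * R + 2)"] large[of R] show False
      by (simp add: seq_character_walsh rank_walsh)
  qed
qed

end
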